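(* Let $s \ge 0$ be an integer and let $a_s(n)$ be the number of leaves among the first $n$ nodes of the infinite labelled tree $\mathcal{F}_s$. If $1 \le n \le s+1$, then $a_s(n) = 1$. If $n = s+2$, then $a_s(n) = 2$. If $n > s+2$, then \[ a_s(n) = a_s\big( n-s-a_s(n-1) \big) + a_s\big( n-s-1-a_s(n-2) \big). \]
   Context: For an integer $s \ge 0$, the infinite tree $\mathcal{F}_s$ is built as follows. It contains an initial single-node tree (one leaf); for each $h \ge 1$ a complete binary tree with $2^h-1$ nodes, called subtree $h$ (so the trees have sizes $1,1,3,7,15,\ldots$); and for each $h\ge 1$ a super-node $y_h$ consisting of $s$ ordinary nodes (no labelled nodes at all if $s=0$). The right child of $y_h$ is the root of subtree $h$; the left child of $y_h$ is $y_{h-1}$ if $h \ge 2$, and is the initial single-node tree if $h=1$. Labels $1,2,3,\ldots$ are given to the nodes in the following order: the initial single node, the $s$ nodes of $y_1$, the nodes of subtree $1$ in preorder, the $s$ nodes of $y_2$, the nodes of subtree $2$ in preorder, and so on. The leaves of $\mathcal{F}_s$ are the initial single node and the leaves of the subtrees $h\ge1$ (all at the bottom level); all other nodes, including those in super-nodes, are internal. For $n\ge 1$, $d_s(n)=1$ if node $n$ is a leaf and $d_s(n)=0$ otherwise; $d_s(0)=0$. Then $a_s(n)=\sum_{j=0}^n d_s(j)$ is the number of leaves (bottom-level nodes) among nodes $1,\ldots,n$. *)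

theory Defs
  imports "HOL-Library.Tree" "HOL-Library.Stream"
begin

(* Throughout, the library constructor Leaf of type tree is the empty tree; a leaf in the
   mathematical sense is a node both of whose children are empty. *)

(* The ordinary nodes: Super h i is the i-th node (i < s) of the super-node y_h, and
   Sub h p is the node of subtree h reached from its root by the path p
   (False: go left, True: go right). *)
datatype node = Initial | Super nat nat | Sub nat "bool list"

primrec paths_tree :: "nat \<Rightarrow> bool list \<Rightarrow> bool list tree" where
  "paths_tree 0 p = Leaf"
| "paths_tree (Suc h) p = Node (paths_tree h (p @ [False])) p (paths_tree h (p @ [True]))"

definition subtree :: "nat \<Rightarrow> node tree" where
  "subtree h = map_tree (Sub h) (paths_tree h [])"

definition super_node :: "nat \<Rightarrow> nat \<Rightarrow> node list" where
  "super_node s h = map (Super h) [0..<s]"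

(* The part of F_s below and including y_h (for h = 0, the initial single-node tree).  Each
   vertex carries the list of the ordinary nodes it consists of: s of them for a super-node,
   exactly one for any other vertex.  F_s has no root; it is the union of the increasing
   chain spine s 0, spine s 1, ..., each being the left child of the next. *)
primrec spine :: "nat \<Rightarrow> nat \<Rightarrow> node list tree" where
  "spine s 0 = Node Leaf [Initial] Leaf"
| "spine s (Suc h) =
     Node (spine s h) (super_node s (Suc h)) (map_tree (\<lambda>x. [x]) (subtree (Suc h)))"

definition is_leaf :: "nat \<Rightarrow> node \<Rightarrow> bool" where
  "is_leaf s x \<longleftrightarrow> (\<exists>h. Node Leaf [x] Leaf \<in> subtrees (spine s h))"

(* Block 0 is the initial node; block h is y_h followed by subtree h in preorder.  The labels
   1, 2, 3, ... run through the concatenation of blocks 0, 1, 2, .... *)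
definition block :: "nat \<Rightarrow> nat \<Rightarrow> node list" where
  "block s h = (if h = 0 then [Initial] else super_node s h @ preorder (subtree h))"

(* The node with label n, for n \<ge> 1 (streams are indexed from 0). *)
definition node_at :: "nat \<Rightarrow> nat \<Rightarrow> node" where
  "node_at s n = flat (smap (block s) nats) !! (n - 1)"

definition leaf_ind :: "nat \<Rightarrow> nat \<Rightarrow> nat" where
  "leaf_ind s n = (if n \<ge> 1 \<and> is_leaf s (node_at s n) then 1 else 0)"

definition leaf_count :: "nat \<Rightarrow> nat \<Rightarrow> nat" where
  "leaf_count s n = (\<Sum>j=0..n. leaf_ind s j)"

lemma height_paths_tree: "height (paths_tree h p) = h"
  by (induction h arbitrary: p) auto

lemma complete_subtree: "complete (subtree h)"
proof -
  have "complete (map_tree (Sub k) (paths_tree h p))" for k p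
    by (induction h arbitrary: p) (auto simp: height_paths_tree)
  then show ?thesis by (simp add: subtree_def)
qed

lemma size_subtree: "size (subtree h) = 2 ^ h - 1"
  using size_if_complete[OF complete_subtree[of h]]
  by (simp add: subtree_def height_paths_tree)

lemma block_nonempty: "block s h \<noteq> []"
  by (cases h) (auto simp: block_def subtree_def)

lemma is_leaf_Initial: "is_leaf s Initial"
  unfolding is_leaf_def by (rule exI[of _ 0]) simp

lemma root_in_subtrees: "Node l v r \<in> subtrees t \<Longrightarrow> v \<in> set_tree t"
  by (induction t) auto

lemma not_is_leaf_Super: "\<not> is_leaf s (Super k i)"
proof -
  have "Node Leaf [Super k i] Leaf \<notin> subtrees (spine s h)" for h
  proof (induction h)
    case (Suc h)
    have "Node Leaf [Super k i] Leaf \<notin> subtrees (map_tree (\<lambda>x. [x]) (subtree (Suc h)))"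
      by (auto dest!: root_in_subtrees simp: subtree_def tree.set_map simp del: paths_tree.simps)
    moreover have "spine s h \<noteq> Leaf" by (cases h) auto
    ultimately show ?case using Suc by auto
  qed auto
  then show ?thesis by (simp add: is_leaf_def)
qed

lemma is_leaf_Sub:
  assumes "length p < h"
  shows "is_leaf s (Sub h p) \<longleftrightarrow> Suc (length p) = h"
proof -
  have 1: "Node Leaf (q @ p) Leaf \<in> subtrees (paths_tree k q) \<longleftrightarrow> Suc (length p) = k" for k q p
  proof (induction k arbitrary: q p)
    case (Suc k)
    have pre: "\<exists>r. v = q' @ r" if "v \<in> set_tree (paths_tree m q')" for v m q'
      using that by (induction m arbitrary: q') fastforce+
    have E: "paths_tree k q' = Leaf \<longleftrightarrow> k = 0" "Leaf = paths_tree k q' \<longleftrightarrow> k = 0" for q'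
      by (cases k; auto)+
    show ?case
    proof (cases p)
      case Nil
      have "Node Leaf q Leaf \<notin> subtrees (paths_tree k (q @ [b]))" for b
        by (auto dest!: root_in_subtrees pre)
      then show ?thesis using Nil by (auto simp: E)
    next
      case (Cons b p')
      have "Node Leaf (q @ b # p') Leaf \<notin> subtrees (paths_tree k (q @ [c]))" if "c \<noteq> b" for c
        using that by (auto dest!: root_in_subtrees pre)
      moreover have "Node Leaf (q @ b # p') Leaf \<in> subtrees (paths_tree k (q @ [b]))
          \<longleftrightarrow> Suc (length p') = k"
        using Suc.IH[of "q @ [b]" p'] by simp
      ultimately show ?thesis using Cons by (cases b) auto
    qed
  qed auto
  have m: "subtrees (map_tree f t) = map_tree f ` subtrees t" for f :: "'a \<Rightarrow> 'b" and t
    by (induction t) auto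
  have 2: "Node Leaf [Sub h p] Leaf \<in> subtrees (map_tree (\<lambda>x. [x]) (subtree k))
      \<longleftrightarrow> h = k \<and> Suc (length p) = k" (is "?L \<longleftrightarrow> ?R") for k
  proof
    assume ?L
    then obtain t where t: "t \<in> subtrees (paths_tree k [])"
      "Node Leaf [Sub h p] Leaf = map_tree (\<lambda>x. [x]) (map_tree (Sub k) t)"
      by (auto simp: m subtree_def)
    then have "t = Node Leaf p Leaf \<and> h = k" by (cases t) auto
    then show ?R using t 1[of "[]" p k] by auto
  next
    assume ?R
    then have "Node Leaf p Leaf \<in> subtrees (paths_tree k [])" "h = k"
      using 1[of "[]" p k] by auto
    then show ?L unfolding m subtree_def by force
  qed
  have 3: "Node Leaf [Sub h p] Leaf \<in> subtrees (spine s k)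
      \<longleftrightarrow> h \<le> k \<and> Suc (length p) = h" for k
  proof (induction k)
    case (Suc k)
    have "spine s k \<noteq> Leaf" by (cases k) auto
    with Suc show ?case using 2[of "Suc k"] by (auto simp: le_Suc_eq)
  qed (use assms in auto)
  show ?thesis unfolding is_leaf_def 3 by auto
qed

(* The subtractions on nat in the recurrence never truncate. *)
lemma leaf_count_add_le:
  assumes "s + 1 \<le> m"
  shows "s + leaf_count s m \<le> m"
proof -
  have blocks: "smap (block s) nats = block s 0 ## block s 1 ## smap (block s) (fromN 2)"
    by (simp add: siterate.ctr[of Suc 0] siterate.ctr[of Suc "Suc 0"] numeral_2_eq_2)
  have fl: "flat (smap (block s) nats)
      = [Initial] @- block s 1 @- flat (smap (block s) (fromN 2))"
    unfolding blocks by (simp add: block_nonempty) (simp add: block_def)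
  have z: "leaf_ind s j = 0" if "j \<in> {2..s+1}" for j
  proof -
    have "node_at s j = super_node s 1 ! (j - 2)"
    proof -
      have "j - 1 = Suc (j - 2)" using that by auto
      then show ?thesis using that
        by (auto simp: node_at_def fl block_def super_node_def nth_append)
    qed
    also have "\<dots> = Super 1 (j - 2)" using that by (auto simp: super_node_def)
    finally show ?thesis by (simp add: leaf_ind_def not_is_leaf_Super)
  qed
  have le: "leaf_ind s j \<le> 1" for j by (simp add: leaf_ind_def)
  have "leaf_count s m = (\<Sum>j\<in>{0..m} - ({0} \<union> {2..s+1}). leaf_ind s j)"
    unfolding leaf_count_def
  proof (intro sum.mono_neutral_right ballI)
    have "leaf_ind s 0 = 0" by (simp add: leaf_ind_def)
    then show "leaf_ind s j = 0" if "j \<in> {0..m} - ({0..m} - ({0} \<union> {2..s+1}))" for j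
      using that z by blast
  qed auto
  also have "\<dots> \<le> (\<Sum>j\<in>{0..m} - ({0} \<union> {2..s+1}). 1)"
    by (intro sum_mono le)
  also have "\<dots> = card ({0..m} - ({0} \<union> {2..s+1}))" by simp
  also have "\<dots> = Suc m - Suc s"
    using assms by (subst card_Diff_subset) (auto simp: card_insert_if)
  finally show ?thesis using assms by simp
qed

lemma no_truncation:
  assumes "n > s + 2"
  shows "s + leaf_count s (n - 1) < n" and "s + 1 + leaf_count s (n - 2) < n"
  using leaf_count_add_le[of s "n - 1"] leaf_count_add_le[of s "n - 2"] assms by linarith+

end

theory Submission
  imports Defs
begin

text \<open>
  Encode the labelled tree as a 0/1 word \<open>W\<close>, with 1 marking the leaves.  If \<open>T\<close> is \<open>W\<close> without
  its first letter, then \<open>T = 0\<^sup>s 1 \<sigma>(T)\<close> for the substitution \<open>\<sigma>: 0 \<mapsto> 0, 1 \<mapsto> 011\<close>, which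
  attaches two leaves to every old leaf: pruning the leaves of the tree reproduces the tree, with
  \<open>y\<^sub>1\<close> contracted to the initial node.  Hence, with \<open>a\<close> for the leaf count, a prefix of \<open>W\<close> of
  length \<open>k \<ge> 1\<close> corresponds to one of length \<open>N\<^sub>k = s + k - 1 + 2a(k)\<close> with \<open>2a(k)\<close> leaves.
  With \<open>q(m) = m + 1 - s - a(m)\<close>, the number \<open>a(q(m))\<close> counts the parents of leaves among the
  first \<open>m\<close> nodes.  Since the two children of such a parent are the next two nodes in preorder,
  \<open>a(n) = a(q(n-1)) + a(q(n-2))\<close>.
\<close>

section \<open>Leaf words and the substitution \<sigma>\<close>

fun leaf_word :: "nat \<Rightarrow> bool list" where
  "leaf_word 0 = []"
| "leaf_word (Suc h) = (h = 0) # leaf_word h @ leaf_word h"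

text \<open>Blocks 1 to \<open>H\<close> without the initial node: a finite prefix of T.\<close>

definition prefix_word :: "nat \<Rightarrow> nat \<Rightarrow> bool list" where
  "prefix_word s H = concat (map (\<lambda>h. replicate s False @ leaf_word (Suc h)) [0..<H])"

definition grow :: "bool list \<Rightarrow> bool list" where
  "grow w = concat (map (\<lambda>b. if b then [False, True, True] else [False]) w)"

lemma grow_simps [simp]:
  "grow [] = []"
  "grow (b # w) = (if b then [False, True, True] else [False]) @ grow w"
  "grow (v @ w) = grow v @ grow w"
  "grow (replicate k False) = replicate k False"
  by (induction k) (auto simp: grow_def)

lemma count_list_replicate_False [simp]: "count_list (replicate k False) True = 0"
  by (induction k) auto

lemma count_grow: "count_list (grow w) True = 2 * count_list w True"
  by (induction w) auto

lemma length_grow: "length (grow w) = length w + 2 * count_list w True"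
  by (induction w) auto

text \<open>Giving every leaf two children adds a level to a complete tree; the empty tree has no
  leaf to grow from.\<close>

lemma grow_leaf_word: "h > 0 \<Longrightarrow> grow (leaf_word h) = leaf_word (Suc h)"
  by (induction h) auto

lemma prefix_word_Suc:
  "prefix_word s (Suc H) = prefix_word s H @ replicate s False @ leaf_word (Suc H)"
  by (simp add: prefix_word_def)

text \<open>\<sigma> keeps the zeros of a super-node and adds a level to the subtree after it, so
  the new block \<open>Suc H\<close> is the image of block \<open>H\<close>; the first block is put
  in front.\<close>

lemma prefix_word_grow:
  "prefix_word s (Suc H) = replicate s False @ True # grow (prefix_word s H)"
proof (induction H)
  case 0
  show ?case by (simp add: prefix_word_def)
next
  case (Suc H)
  have "grow (prefix_word s (Suc H))
      = grow (prefix_word s H) @ replicate s False @ leaf_word (Suc (Suc H))"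
    using grow_leaf_word[of "Suc H"]
    by (simp add: prefix_word_Suc del: leaf_word.simps)
  then show ?case
    using Suc.IH by (simp add: prefix_word_Suc[of s "Suc H"] del: leaf_word.simps)
qed

lemma length_prefix_word_ge: "H \<le> length (prefix_word s H)"
proof (induction H)
  case (Suc H)
  then show ?case by (simp add: prefix_word_Suc)
qed simp

section \<open>Leaf pattern of the labelled nodes\<close>

lemma map_is_leaf_subtree: "map (is_leaf s) (preorder (subtree h)) = leaf_word h"
proof -
  \<comment> \<open>The subtree index \<open>length p + k\<close> is unchanged when the path grows
    and \<open>k\<close> drops.\<close>
  have "map (is_leaf s) (map (Sub (length p + k)) (preorder (paths_tree k p))) = leaf_word k"
    for k p
  proof (induction k arbitrary: p)
    case (Suc k)
    show ?case using Suc.IH[of "p @ [False]"] Suc.IH[of "p @ [True]"] by (auto simp: is_leaf_Sub)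
  qed simp
  from this[of "[]" h] show ?thesis by (simp add: subtree_def preorder_map)
qed

lemma map_is_leaf_block:
  "map (is_leaf s) (block s (Suc h)) = replicate s False @ leaf_word (Suc h)"
  by (auto simp: block_def map_is_leaf_subtree super_node_def not_is_leaf_Super
      intro!: nth_equalityI simp del: leaf_word.simps)

lemma map_is_leaf_blocks:
  "map (is_leaf s) (concat (map (block s) [0..<Suc H])) = True # prefix_word s H"
proof (induction H)
  case 0
  show ?case by (simp add: block_def is_leaf_Initial prefix_word_def)
next
  case (Suc H)
  then show ?case
    by (simp add: prefix_word_Suc map_is_leaf_block del: leaf_word.simps)
qed

lemma flat_smap_nats:
  assumes "\<And>h. f h \<noteq> []"
  shows "flat (smap f nats) = concat (map f [0..<H]) @- flat (smap f (fromN H))"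
proof (induction H)
  case (Suc H)
  have "flat (smap f (fromN H)) = f H @- flat (smap f (fromN (Suc H)))"
    by (subst siterate.ctr) (simp add: assms)
  then show ?case using Suc by simp
qed simp

lemma leaf_count_length:
  assumes "flat (smap (block s) nats) = xs @- ys"
  shows "leaf_count s (length xs) = count_list (map (is_leaf s) xs) True"
  using assms
proof (induction xs arbitrary: ys rule: rev_induct)
  case Nil
  show ?case by (simp add: leaf_count_def leaf_ind_def)
next
  case (snoc x xs)
  have "node_at s (Suc (length xs)) = x"
    by (simp add: node_at_def snoc.prems)
  then have "leaf_ind s (Suc (length xs)) = of_bool (is_leaf s x)"
    by (simp add: leaf_ind_def)
  moreover have "leaf_count s (length xs) = count_list (map (is_leaf s) xs) True"
    using snoc.IH[of "x ## ys"] snoc.prems by simp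
  ultimately show ?case by (simp add: leaf_count_def)
qed

text \<open>Both \<open>Suc\<close> account for the initial node, which \<open>prefix_word\<close>
  omits.\<close>

lemma leaf_count_prefix:
  assumes "prefix_word s H = u @ v"
  shows "leaf_count s (Suc (length u)) = Suc (count_list u True)"
proof -
  define bs where "bs = concat (map (block s) [0..<Suc H])"
  have bs: "map (is_leaf s) bs = True # u @ v"
    unfolding bs_def map_is_leaf_blocks assms ..
  define xs where "xs = take (Suc (length u)) bs"
  have len: "length xs = Suc (length u)"
    using arg_cong[OF bs, of length] by (simp add: xs_def)
  have "flat (smap (block s) nats) = bs @- flat (smap (block s) (fromN (Suc H)))"
    unfolding bs_def by (rule flat_smap_nats) (rule block_nonempty)
  also have "\<dots> = xs @- drop (Suc (length u)) bs @- flat (smap (block s) (fromN (Suc H)))"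
    by (simp add: xs_def flip: shift_append)
  finally have "leaf_count s (length xs) = count_list (map (is_leaf s) xs) True"
    by (rule leaf_count_length)
  moreover have "map (is_leaf s) xs = True # u"
    by (simp add: xs_def bs flip: take_map)
  ultimately show ?thesis by (simp add: len)
qed

section \<open>Leaf counts under \<sigma>\<close>

lemma leaf_count_le_Suc_s:
  assumes "1 \<le> n" "n \<le> s + 1"
  shows "leaf_count s n = 1"
proof -
  have "prefix_word s 1 = replicate (n - 1) False @ replicate (s + 1 - n) False @ [True]"
    using assms by (simp add: prefix_word_def flip: append_assoc replicate_add)
  from leaf_count_prefix[OF this] show ?thesis using assms by simp
qed

text \<open>The second alternative is the case that node \<open>k + 1\<close> is a leaf.\<close>

lemma leaf_count_grow:
  assumes "k \<ge> 1" and N: "N = s + k - 1 + 2 * leaf_count s k"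
  shows "leaf_count s N = 2 * leaf_count s k"
    and "leaf_count s (Suc k) = leaf_count s k \<or>
      leaf_count s (Suc k) = leaf_count s k + 1 \<and>
      leaf_count s (N + 1) = 2 * leaf_count s k \<and>
      leaf_count s (N + 2) = 2 * leaf_count s k + 1"
proof -
  \<comment> \<open>Nodes 2 to \<open>k\<close> give the \<open>k - 1\<close> letters of
    \<open>u\<close>; the next letter \<open>b\<close> belongs to node \<open>k + 1\<close>.\<close>
  define u where "u = take (k - 1) (prefix_word s k)"
  have ge: "k \<le> length (prefix_word s k)" by (rule length_prefix_word_ge)
  have len: "length u = k - 1" using ge by (simp add: u_def)
  have "drop (k - 1) (prefix_word s k) \<noteq> []" using ge assms(1) by simp
  then obtain b v where "drop (k - 1) (prefix_word s k) = b # v"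
    by (meson neq_Nil_conv)
  then have P: "prefix_word s k = u @ b # v"
    unfolding u_def by (metis append_take_drop_id)
  have ak: "leaf_count s k = Suc (count_list u True)"
    using leaf_count_prefix[OF P] len assms(1) by simp
  have ak': "leaf_count s (Suc k) = leaf_count s k + of_bool b"
    using leaf_count_prefix[of s k "u @ [b]" v] P len assms(1) ak by simp
  \<comment> \<open>With the initial node in front, this is the image of the first \<open>k\<close>
    nodes.\<close>
  let ?w = "replicate s False @ True # grow u"
  have P': "prefix_word s (Suc k) = ?w @ grow (b # v)"
    by (simp add: prefix_word_grow P)
  have w: "Suc (length ?w) = N" "count_list ?w True = Suc (2 * count_list u True)"
    using assms(1) by (simp_all add: N ak len length_grow count_grow)
  show "leaf_count s N = 2 * leaf_count s k"
    using leaf_count_prefix[OF P'] w ak by simp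
  show "leaf_count s (Suc k) = leaf_count s k \<or>
      leaf_count s (Suc k) = leaf_count s k + 1 \<and>
      leaf_count s (N + 1) = 2 * leaf_count s k \<and>
      leaf_count s (N + 2) = 2 * leaf_count s k + 1"
  proof (cases b)
    case True
    have "leaf_count s (N + 1) = 2 * leaf_count s k"
      using leaf_count_prefix[of s "Suc k" "?w @ [False]" "[True, True] @ grow v"] w ak P' True
      by simp
    moreover have "leaf_count s (N + 2) = 2 * leaf_count s k + 1"
      using leaf_count_prefix[of s "Suc k" "?w @ [False, True]" "[True] @ grow v"] w ak P' True
      by simp
    ultimately show ?thesis using ak' True by simp
  qed (use ak' in simp)
qed

section \<open>The recurrence\<close>

context
  fixes s :: nat and a N q :: "nat \<Rightarrow> nat"
  defines "a \<equiv> leaf_count s"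
    and "N \<equiv> \<lambda>k. s + k - 1 + 2 * a k"
    and "q \<equiv> \<lambda>m. m + 1 - s - a m"
begin

text \<open>\<open>a (N k) = 2 * a k\<close> cancels the last term of \<open>N k\<close>.\<close>

lemma q_N: "k \<ge> 1 \<Longrightarrow> q (N k) = k"
  using leaf_count_grow(1)[of k "N k" s] by (simp add: q_def N_def a_def)

text \<open>If node \<open>k + 1\<close> is internal, its image is one node. If it is a leaf, its
  image is a parent followed by two leaves, and \<open>q\<close> already counts the parent once it
  is passed.\<close>

lemma N_step:
  assumes "k \<ge> 1"
  obtains "a (k + 1) = a k" "N (k + 1) = N k + 1"
  | "a (k + 1) = a k + 1" "N (k + 1) = N k + 3" "a (N k + 1) = 2 * a k"
    "a (N k + 2) = 2 * a k + 1" "q (N k + 1) = k + 1" "q (N k + 2) = k + 1"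
proof -
  have "a (Suc k) = a k \<or> a (Suc k) = a k + 1 \<and> a (N k + 1) = 2 * a k
      \<and> a (N k + 2) = 2 * a k + 1"
    using leaf_count_grow(2)[OF assms, of "N k" s] by (simp add: N_def a_def)
  then show thesis
  proof (elim disjE conjE)
    assume "a (Suc k) = a k"
    then show thesis using assms by (intro that(1)) (auto simp: N_def)
  next
    assume *: "a (Suc k) = a k + 1" "a (N k + 1) = 2 * a k" "a (N k + 2) = 2 * a k + 1"
    then have "q (N k + 1) = k + 1" "q (N k + 2) = k + 1"
      using assms by (simp_all add: q_def) (simp_all add: N_def)
    then show thesis using * assms by (intro that(2)) (auto simp: N_def)
  qed
qed

lemma N_1: "N 1 = s + 2"
  by (simp add: N_def a_def leaf_count_le_Suc_s)

text \<open>Needed because the recurrence at \<open>N k + 1\<close> looks back to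
  \<open>N k - 1\<close>, where \<open>q\<close> itself may differ from \<open>k\<close>.\<close>

lemma a_q_before_N:
  assumes "k \<ge> 1"
  shows "a (q (N k - 1)) = a k"
  using assms
proof (induction k rule: nat_induct_at_least)
  case base
  have "q (s + 1) = 1" by (simp add: q_def a_def leaf_count_le_Suc_s)
  then show ?case by (simp add: N_1[simplified])
next
  case (Suc k)
  from \<open>1 \<le> k\<close> show ?case
  proof (cases rule: N_step)
    case 1
    then show ?thesis using q_N[OF Suc.hyps] by simp
  next
    case 2
    then show ?thesis by (simp add: numeral_3_eq_3)
  qed
qed

text \<open>Each induction step adds the one or three positions after \<open>N k\<close>, where
  \<open>N_step\<close> gives all values of \<open>a\<close> and \<open>q\<close>.\<close>

lemma recurrence_upto_N:
  assumes "k \<ge> 1" "s + 2 < n" "n \<le> N k"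
  shows "a n = a (q (n - 1)) + a (q (n - 2))"
  using assms
proof (induction k rule: nat_induct_at_least)
  case base
  then show ?case using N_1 by simp
next
  case (Suc k)
  note qs = q_N[OF Suc.hyps] a_q_before_N[OF Suc.hyps]
  show ?case
  proof (cases "n \<le> N k")
    case True
    then show ?thesis using Suc by blast
  next
    case False
    have aN: "a (N (k + 1)) = 2 * a (k + 1)"
      using leaf_count_grow(1)[of "k + 1" "N (k + 1)" s] by (simp add: N_def a_def)
    from \<open>1 \<le> k\<close> show ?thesis
    proof (cases rule: N_step)
      case 1
      then have "n = N k + 1" using False Suc.prems by simp
      then show ?thesis using 1 qs aN by simp
    next
      case 2
      consider "n = N k + 1" | "n = N k + 2" | "n = N k + 3"
        using False Suc.prems 2 by force
      then show ?thesis
        using 2 qs aN by cases (simp_all add: numeral_3_eq_3)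
    qed
  qed
qed

lemma recurrence:
  assumes "s + 2 < n"
  shows "a n = a (q (n - 1)) + a (q (n - 2))"
proof (rule recurrence_upto_N)
  show "n + 1 \<ge> 1" by simp
  show "n \<le> N (n + 1)" by (simp add: N_def)
qed (rule assms)

end

theorem theorem2p1:
  fixes s n :: nat
  shows "(1 \<le> n \<and> n \<le> s + 1 \<longrightarrow> leaf_count s n = 1) \<and>
    (n = s + 2 \<longrightarrow> leaf_count s n = 2) \<and>
    (n > s + 2 \<longrightarrow>
      leaf_count s n = leaf_count s (n - s - leaf_count s (n - 1)) +
                       leaf_count s (n - s - 1 - leaf_count s (n - 2)))"
proof (intro conjI impI)
  show "leaf_count s n = 1" if "1 \<le> n \<and> n \<le> s + 1"
    using that leaf_count_le_Suc_s by blast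
  show "leaf_count s n = 2" if "n = s + 2"
    \<comment> \<open>\<open>k = 1\<close> yields the prefix length \<open>s + 2\<close>.\<close>
    using leaf_count_grow(1)[of 1 n s] that by (simp add: leaf_count_le_Suc_s)
  assume n: "n > s + 2"
  then have "n - 1 + 1 - s = n - s" "n - 2 + 1 - s = n - s - 1" by auto
  then show "leaf_count s n = leaf_count s (n - s - leaf_count s (n - 1)) +
      leaf_count s (n - s - 1 - leaf_count s (n - 2))"
    using recurrence[OF n] by simp
qed

end
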